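(* Let $G$ be a graph, $H$ a subgraph of $G$, and $A$ a finite abelian group. (1) If $H$ is $A$-connected, then $G/H$ is $A$-flow-connected whenever $G$ is $A$-flow-connected. (2) Moreover, if $H$ is $A$-FRC, then $G/H$ is $A$-flow-connected if and only if $G$ is $A$-flow-connected.
   Context: Graphs are finite; parallel edges are allowed. $G/H$ is obtained from $G$ by contracting $H$ to a single vertex (identifying all vertices of $H$ and removing the edges of $H$), with any resulting loops deleted. A cycle is a connected 2-regular graph (two parallel edges form a cycle of length 2). Fix an arbitrary orientation $D$ of a graph $G$; let $E_D^+(v)$, $E_D^-(v)$ be the sets of edges directed out of and into $v$. An $A$-boundary of $G$ is a function $\beta:V(G)\to A$ with $\sum_{v}\beta(v)=0_A$. A $\beta$-flow (always nowhere-zero) is a function $f:E(G)\to A\setminus\{0_A\}$ with $\sum_{e\in E_D^+(v)}f(e)-\sum_{e\in E_D^-(v)}f(e)=\beta(v)$ for every vertex $v$; an $A$-flow is a $\beta$-flow for $\beta\equiv 0_A$. (Flows given with different orientations are identified by negating the value of every edge whose orientation is reversed, so the choice of $D$ does not matter.) Two $\beta$-flows are adjacent if there is a cycle $C$ in $G$ such that they agree on all edges outside $E(C)$, and equivalent if they are joined by a finite sequence of $\beta$-flows in which consecutive ones are adjacent. $G$ is $\beta$-flow-connected (for $\beta\equiv 0_A$: $A$-flow-connected) if all its $\beta$-flows are pairwise equivalent (vacuously true if there are none). A graph $H$ is $A$-connected if it admits a $\beta$-flow for every $A$-boundary $\beta$ of $H$. If $\beta_1,\beta_2$ are $A$-boundaries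 of $H$ that differ only at two (distinct) vertices $v_1,v_2$, then $H$ is $(\beta_1,\beta_2)$-flow-convertible if there exist a $\beta_1$-flow $f_1$ and a $\beta_2$-flow $f_2$ (with the same orientation) such that $f_1-f_2$ is supported on a path with endpoints $v_1$ and $v_2$ (i.e. the edges on which $f_1\ne f_2$ are exactly the edges of such a path). $H$ is $A$-flow-reconfiguration-contractible ($A$-FRC) if: (i) $H$ is $A$-connected; (ii) for every $A$-boundary $\beta$ of $H$, $H$ is $\beta$-flow-connected; (iii) for any two $A$-boundaries $\beta_1,\beta_2$ that differ only at two vertices, $H$ is $(\beta_1,\beta_2)$-flow-convertible. *)

theory Defs
  imports Main "HOL-Library.FuncSet" "Graph_Theory.Digraph"
begin

text \<open>
  Finite undirected graphs with parallel edges and without loops. Edges are objects of their own,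
  so subgraphs, cycles and paths are determined by sets of edges, not merely of vertex pairs.
\<close>

record ('v, 'e) mgraph =
  mverts :: "'v set"
  medges :: "'e set"
  ends :: "'e \<Rightarrow> 'v set"

definition multigraph :: "('v, 'e) mgraph \<Rightarrow> bool" where
  "multigraph G \<longleftrightarrow> finite (mverts G) \<and> finite (medges G) \<and>
     (\<forall>e\<in>medges G. ends G e \<subseteq> mverts G \<and> card (ends G e) = 2)"

definition msubgraph :: "('v, 'e) mgraph \<Rightarrow> ('v, 'e) mgraph \<Rightarrow> bool" where
  "msubgraph H G \<longleftrightarrow> multigraph H \<and> multigraph G \<and>
     mverts H \<subseteq> mverts G \<and> medges H \<subseteq> medges G \<and> (\<forall>e\<in>medges H. ends H e = ends G e)"

text \<open>
  In \<open>G/H\<close> the vertex \<open>None\<close> is the one to which \<open>H\<close> is contracted. Removing the loops that arise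
  means keeping only those remaining edges whose ends stay distinct.
\<close>

definition contract_vertex :: "('v, 'e) mgraph \<Rightarrow> 'v \<Rightarrow> 'v option" where
  "contract_vertex H v = (if v \<in> mverts H then None else Some v)"

definition contract :: "('v, 'e) mgraph \<Rightarrow> ('v, 'e) mgraph \<Rightarrow> ('v option, 'e) mgraph" where
  "contract G H =
     \<lparr> mverts = contract_vertex H ` mverts G,
       medges = {e \<in> medges G - medges H. card (contract_vertex H ` ends G e) = 2},
       ends = (\<lambda>e. contract_vertex H ` ends G e) \<rparr>"

definition mdegree :: "('v, 'e) mgraph \<Rightarrow> 'v \<Rightarrow> nat" where
  "mdegree G v = card {e \<in> medges G. v \<in> ends G e}"

definition mconnected :: "('v, 'e) mgraph \<Rightarrow> bool" where
  "mconnected G \<longleftrightarrow> mverts G \<noteq> {} \<and>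
     (\<forall>u\<in>mverts G. \<forall>v\<in>mverts G. (u, v) \<in> {(x, y). \<exists>e\<in>medges G. ends G e = {x, y}}\<^sup>*)"

definition is_cycle :: "('v, 'e) mgraph \<Rightarrow> bool" where
  "is_cycle C \<longleftrightarrow> multigraph C \<and> mconnected C \<and> (\<forall>v\<in>mverts C. mdegree C v = 2)"

definition is_path :: "('v, 'e) mgraph \<Rightarrow> 'v \<Rightarrow> 'v list \<Rightarrow> 'e list \<Rightarrow> 'v \<Rightarrow> bool" where
  "is_path G u vs es v \<longleftrightarrow>
     set vs \<subseteq> mverts G \<and> set es \<subseteq> medges G \<and> distinct vs \<and> length vs = Suc (length es) \<and>
     hd vs = u \<and> last vs = v \<and> (\<forall>i<length es. ends G (es ! i) = {vs ! i, vs ! Suc i})"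

definition orientation :: "('v, 'e) mgraph \<Rightarrow> ('v, 'e) pre_digraph \<Rightarrow> bool" where
  "orientation G D \<longleftrightarrow> verts D = mverts G \<and> arcs D = medges G \<and>
     (\<forall>e\<in>medges G. {tail D e, head D e} = ends G e)"

definition boundary :: "('v, 'e) mgraph \<Rightarrow> ('v \<Rightarrow> 'a::ab_group_add) \<Rightarrow> bool" where
  "boundary G \<beta> \<longleftrightarrow> (\<Sum>v\<in>mverts G. \<beta> v) = 0"

text \<open>
  A flow is a function on the edge set only: the extensional function space makes two flows
  equal as soon as they agree on all edges.
\<close>

definition flows :: "('v, 'e) mgraph \<Rightarrow> ('v, 'e) pre_digraph \<Rightarrow> ('v \<Rightarrow> 'a::ab_group_add) \<Rightarrow> ('e \<Rightarrow> 'a) set"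
  where
  "flows G D \<beta> = {f \<in> medges G \<rightarrow>\<^sub>E (UNIV - {0}).
     \<forall>v\<in>mverts G. (\<Sum>e\<in>out_arcs D v. f e) - (\<Sum>e\<in>in_arcs D v. f e) = \<beta> v}"

definition flow_adjacent ::
  "('v, 'e) mgraph \<Rightarrow> ('v, 'e) pre_digraph \<Rightarrow> ('v \<Rightarrow> 'a::ab_group_add) \<Rightarrow> (('e \<Rightarrow> 'a) \<times> ('e \<Rightarrow> 'a)) set"
  where
  "flow_adjacent G D \<beta> = {(f, g). f \<in> flows G D \<beta> \<and> g \<in> flows G D \<beta> \<and>
     (\<exists>C. msubgraph C G \<and> is_cycle C \<and> (\<forall>e\<in>medges G - medges C. f e = g e))}"

text \<open>
  The properties below do not depend on the orientation (reversing an edge negates the flow value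
  on it), so they are stated for an arbitrary one; by \<open>orientation_exists\<close> there always is one.
\<close>

lemma orientation_exists:
  assumes "multigraph G"
  shows "\<exists>D. orientation G D"
proof -
  have "\<forall>e\<in>medges G. \<exists>p. {fst p, snd p} = ends G e"
    using assms by (fastforce simp: multigraph_def card_2_iff)
  then obtain p where "\<forall>e\<in>medges G. {fst (p e), snd (p e)} = ends G e"
    by metis
  then have "orientation G \<lparr>verts = mverts G, arcs = medges G, tail = fst \<circ> p, head = snd \<circ> p\<rparr>"
    by (simp add: orientation_def)
  then show ?thesis ..
qed

definition flow_connected :: "('v, 'e) mgraph \<Rightarrow> ('v \<Rightarrow> 'a::ab_group_add) \<Rightarrow> bool" where
  "flow_connected G \<beta> \<longleftrightarrow> (\<forall>D. orientation G D \<longrightarrow>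
     (\<forall>f\<in>flows G D \<beta>. \<forall>g\<in>flows G D \<beta>. (f, g) \<in> (flow_adjacent G D \<beta>)\<^sup>*))"

definition group_flow_connected :: "'a::ab_group_add itself \<Rightarrow> ('v, 'e) mgraph \<Rightarrow> bool" where
  "group_flow_connected A G \<longleftrightarrow> flow_connected G (\<lambda>v. 0 :: 'a)"

definition group_connected :: "'a::ab_group_add itself \<Rightarrow> ('v, 'e) mgraph \<Rightarrow> bool" where
  "group_connected A H \<longleftrightarrow> (\<forall>\<beta> :: 'v \<Rightarrow> 'a. boundary H \<beta> \<longrightarrow>
     (\<forall>D. orientation H D \<longrightarrow> flows H D \<beta> \<noteq> {}))"

definition differ_only_at :: "('v, 'e) mgraph \<Rightarrow> ('v \<Rightarrow> 'a) \<Rightarrow> ('v \<Rightarrow> 'a) \<Rightarrow> 'v \<Rightarrow> 'v \<Rightarrow> bool" where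
  "differ_only_at H \<beta>1 \<beta>2 v1 v2 \<longleftrightarrow> v1 \<noteq> v2 \<and> {v \<in> mverts H. \<beta>1 v \<noteq> \<beta>2 v} = {v1, v2}"

definition flow_convertible ::
  "('v, 'e) mgraph \<Rightarrow> ('v \<Rightarrow> 'a::ab_group_add) \<Rightarrow> ('v \<Rightarrow> 'a) \<Rightarrow> 'v \<Rightarrow> 'v \<Rightarrow> bool" where
  "flow_convertible H \<beta>1 \<beta>2 v1 v2 \<longleftrightarrow> (\<forall>D. orientation H D \<longrightarrow>
     (\<exists>f1\<in>flows H D \<beta>1. \<exists>f2\<in>flows H D \<beta>2. \<exists>vs es.
        is_path H v1 vs es v2 \<and> {e \<in> medges H. f1 e \<noteq> f2 e} = set es))"

text \<open>\<open>A\<close>-flow-reconfiguration-contractible (\<open>A\<close>-FRC) graphs.\<close>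

definition FRC :: "'a::ab_group_add itself \<Rightarrow> ('v, 'e) mgraph \<Rightarrow> bool" where
  "FRC A H \<longleftrightarrow>
     group_connected A H \<and>
     (\<forall>\<beta> :: 'v \<Rightarrow> 'a. boundary H \<beta> \<longrightarrow> flow_connected H \<beta>) \<and>
     (\<forall>(\<beta>1 :: 'v \<Rightarrow> 'a) \<beta>2 v1 v2. boundary H \<beta>1 \<longrightarrow> boundary H \<beta>2 \<longrightarrow>
        differ_only_at H \<beta>1 \<beta>2 v1 v2 \<longrightarrow> flow_convertible H \<beta>1 \<beta>2 v1 v2)"

end

theory Submission
  imports Defs
begin

text \<open>
  The proof rests on one criterion (\<open>flows_equivalent_if_difference_degree_le_2\<close>): two flows with
  the same boundary are equivalent as soon as the set \<open>S\<close> of edges on which they differ has at most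
  two edges at every vertex, with one vertex \<open>z\<close> exempt. Indeed a conservation law forbids vertices
  of \<open>S\<close>-degree one, so \<open>S\<close> contains a cycle; that cycle uses all edges of \<open>S\<close> at each of its
  vertices other than \<open>z\<close>, so switching from one flow to the other along it keeps the boundary
  everywhere except perhaps at \<open>z\<close>, and at \<open>z\<close> because boundaries sum to zero. Repeating this
  exhausts \<open>S\<close>. The criterion deals with differences that are not a single cycle, such as the image
  of a cycle of \<open>G\<close> in \<open>G/H\<close>, which may pass many times through the contracted vertex, and it spares
  any discussion of how pieces of cycles and paths fit together.

  From \<open>G\<close> to \<open>G/H\<close>: since \<open>H\<close> is \<open>A\<close>-connected, every flow of \<open>G/H\<close> is the restriction of a
  flow of \<open>G\<close> (\<open>contract_flow_lifts\<close>). A sequence of adjacent flows joining two such lifts restricts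
  to flows of \<open>G/H\<close>, and consecutive restrictions are equivalent by the criterion with the contracted
  vertex as \<open>z\<close> (\<open>contract_adjacent\<close>).

  From \<open>G/H\<close> to \<open>G\<close>, for \<open>H\<close> an \<open>A\<close>-FRC graph: two flows of \<open>G\<close> that agree outside \<open>H\<close> are
  equivalent because \<open>H\<close> is flow-connected for the boundary that the outside imposes on it
  (\<open>equivalent_if_equal_outer\<close>). Now let the values outside \<open>H\<close> change on a set \<open>T\<close> of edges meeting
  \<open>H\<close> at most twice. Then the imposed boundary changes at no vertex or at exactly two, and in the
  latter case convertibility lets \<open>H\<close> absorb the change along a path which, together with \<open>T\<close>, still
  has degree at most two (\<open>change_outer_values\<close>). This one move lifts an adjacency in \<open>G/H\<close>
  (\<open>lift_adjacent\<close>), and it also adjusts, one at a time, the edges that are loops in \<open>G/H\<close> and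
  whose values are therefore invisible there (\<open>equivalent_if_equal_contract\<close>).
\<close>

section \<open>Cycles in edge sets without leaves\<close>

definition edges_at :: "('e \<Rightarrow> 'v set) \<Rightarrow> 'e set \<Rightarrow> 'v \<Rightarrow> 'e set" where
  "edges_at en S v = {e \<in> S. v \<in> en e}"

lemma finite_edges_at [simp]: "finite S \<Longrightarrow> finite (edges_at en S v)"
  by (simp add: edges_at_def)

lemma edges_at_mono: "S \<subseteq> T \<Longrightarrow> edges_at en S v \<subseteq> edges_at en T v"
  by (auto simp: edges_at_def)

text \<open>
  A finite edge set all of whose nonempty subsets have a leaf is a forest, and a forest has fewer
  edges than vertices: removing a leaf with its edge lowers both numbers.
\<close>

lemma forest_card_less:
  assumes "finite F" "F \<noteq> {}" "\<And>e. e \<in> F \<Longrightarrow> card (en e) = 2"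
    and "\<And>K. K \<subseteq> F \<Longrightarrow> K \<noteq> {} \<Longrightarrow> \<exists>v. card (edges_at en K v) = 1"
  shows "card F < card (\<Union>(en ` F))"
  using assms
proof (induction "card F" arbitrary: F)
  case 0
  then show ?case by simp
next
  case (Suc n)
  have fin: "finite (en e)" if "e \<in> F" for e
    using Suc.prems(3)[OF that] card.infinite by fastforce
  obtain v where "card (edges_at en F v) = 1"
    using Suc.prems(2,4) by blast
  then obtain e where e: "edges_at en F v = {e}"
    by (meson card_1_singletonE)
  then have eF: "e \<in> F" "v \<in> en e"
    by (auto simp: edges_at_def)
  have v: "v \<notin> \<Union>(en ` (F - {e}))"
    using e by (auto simp: edges_at_def)
  have finU: "finite (\<Union>(en ` F))"
    using fin Suc.prems(1) by blast
  show ?case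
  proof (cases "F = {e}")
    case True
    then show ?thesis using Suc.prems(3) by simp
  next
    case False
    have "card (F - {e}) < card (\<Union>(en ` (F - {e})))"
    proof (rule Suc.hyps(1))
      show "n = card (F - {e})"
        using Suc.hyps(2) eF Suc.prems(1) by simp
      show "F - {e} \<noteq> {}"
        using False eF by blast
      show "card (en e') = 2" if "e' \<in> F - {e}" for e'
        using Suc.prems(3) that by blast
      show "\<exists>v. card (edges_at en K v) = 1" if "K \<subseteq> F - {e}" "K \<noteq> {}" for K
        using Suc.prems(4)[of K] that by blast
    qed (use Suc.prems(1) in simp)
    also have "\<dots> \<le> card (\<Union>(en ` F) - {v})"
      using v finU by (intro card_mono) auto
    also have "\<dots> = card (\<Union>(en ` F)) - 1"
      using eF by (subst card_Diff_singleton) auto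
    finally show ?thesis
      using eF Suc.prems(1) by (simp add: card_Diff_singleton)
  qed
qed

lemma handshake:
  assumes "finite K" "finite V" "\<And>e. e \<in> K \<Longrightarrow> finite (en e)"
  shows "(\<Sum>v\<in>V. card (edges_at en K v)) = (\<Sum>e\<in>K. card (en e \<inter> V))"
proof -
  have "(\<Sum>v\<in>V. card (edges_at en K v)) = (\<Sum>v\<in>V. \<Sum>e\<in>K. if v \<in> en e then 1 else 0)"
    using assms(1) by (intro sum.cong) (auto simp: edges_at_def sum.If_cases Int_def)
  also have "\<dots> = (\<Sum>e\<in>K. \<Sum>v\<in>V. if v \<in> en e then 1 else 0)"
    by (rule sum.swap)
  also have "\<dots> = (\<Sum>e\<in>K. card (en e \<inter> V))"
    using assms(2) by (intro sum.cong) (auto simp: sum.If_cases Int_def conj_commute)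
  finally show ?thesis .
qed

text \<open>
  A minimal nonempty leafless \<open>K \<subseteq> S\<close> is a cycle. It is connected because its components are
  leafless too. Removing one edge leaves a forest, so \<open>K\<close> has at most as many edges as vertices;
  as all its degrees are at least two, counting incidences makes all of them exactly two.
\<close>

lemma leafless_contains_cycle:
  assumes "finite S" "S \<noteq> {}" and card2: "\<And>e. e \<in> S \<Longrightarrow> card (en e) = 2"
    and "\<And>v. card (edges_at en S v) \<noteq> 1"
  obtains K where "K \<subseteq> S" "K \<noteq> {}"
    "is_cycle \<lparr>mverts = \<Union>(en ` K), medges = K, ends = en\<rparr>"
proof -
  define P where "P K \<longleftrightarrow> K \<subseteq> S \<and> K \<noteq> {} \<and> (\<forall>v. card (edges_at en K v) \<noteq> 1)" for K
  have "P S"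
    using assms by (simp add: P_def)
  then obtain K where K: "P K" and minimal: "\<And>L. P L \<Longrightarrow> card K \<le> card L"
    using ex_has_least_nat[of P S card] by blast
  have KS: "K \<subseteq> S" "K \<noteq> {}" and leafless: "\<And>v. card (edges_at en K v) \<noteq> 1"
    using K by (auto simp: P_def)
  have finK: "finite K"
    using KS assms(1) finite_subset by blast
  have subK: "L = K" if "L \<subseteq> K" "P L" for L
    using that minimal[of L] finK by (simp add: card_subset_eq card_mono le_antisym)
  define V where "V = \<Union>(en ` K)"
  have fin: "finite (en e)" if "e \<in> K" for e
    using card2[of e] that KS card.infinite by fastforce
  have finV: "finite V"
    using fin finK by (simp add: V_def)
  have deg: "2 \<le> card (edges_at en K v)" if "v \<in> V" for v
  proof -
    have "edges_at en K v \<noteq> {}"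
      using that by (auto simp: V_def edges_at_def)
    then have "card (edges_at en K v) \<noteq> 0"
      using finK by simp
    then show ?thesis
      using leafless[of v] by linarith
  qed
  obtain e where e: "e \<in> K"
    using KS by blast
  have "K - {e} \<noteq> {}"
  proof
    assume "K - {e} = {}"
    then have "K = {e}" using e by blast
    moreover obtain v where "v \<in> en e"
      using card2[of e] e KS by fastforce
    ultimately have "edges_at en K v = {e}"
      by (auto simp: edges_at_def)
    then show False using leafless[of v] by simp
  qed
  \<comment> \<open>By minimality no nonempty subset of \<open>K - {e}\<close> is leafless.\<close>
  have "card (K - {e}) < card (\<Union>(en ` (K - {e})))"
  proof (rule forest_card_less)
    fix L assume L: "L \<subseteq> K - {e}" "L \<noteq> {}"
    then have "\<not> P L"
      using subK[of L] e by blast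
    then show "\<exists>v. card (edges_at en L v) = 1"
      using L KS by (auto simp: P_def)
  qed (use \<open>K - {e} \<noteq> {}\<close> finK card2 KS in auto)
  also have "\<dots> \<le> card V"
    using finV by (intro card_mono) (auto simp: V_def)
  finally have le: "card K \<le> card V"
    using e finK by (simp add: card_Diff_singleton)
  have "(\<Sum>v\<in>V. card (edges_at en K v)) = (\<Sum>e\<in>K. card (en e \<inter> V))"
    using handshake[OF finK finV fin] .
  also have "\<dots> = (\<Sum>e\<in>K. 2)"
    using card2 KS by (intro sum.cong) (auto simp: V_def Int_absorb2 UN_upper)
  finally have sum: "(\<Sum>v\<in>V. card (edges_at en K v)) \<le> (\<Sum>v\<in>V. 2)"
    using le by simp
  have deg2: "card (edges_at en K v) = 2" if "v \<in> V" for v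
  proof (rule ccontr)
    assume "card (edges_at en K v) \<noteq> 2"
    then have "2 < card (edges_at en K v)"
      using deg[OF that] by simp
    then have "(\<Sum>v\<in>V. 2) < (\<Sum>v\<in>V. card (edges_at en K v))"
      using that finV deg by (intro sum_strict_mono_ex1) auto
    then show False using sum by simp
  qed
  define R where "R = {(x, y). \<exists>e\<in>K. en e = {x, y}}"
  have conn: "(u, v) \<in> R\<^sup>*" if u: "u \<in> V" and v: "v \<in> V" for u v
  proof -
    \<comment> \<open>The edges of the component of \<open>u\<close>; they form a leafless set, hence all of \<open>K\<close>.\<close>
    define L where "L = {e \<in> K. en e \<subseteq> R\<^sup>* `` {u}}"
    have other: "\<exists>y. en e = {x, y}" if "e \<in> K" "x \<in> en e" for e x
    proof -
      have "card (en e) = 2" using card2 that KS by blast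
      then obtain a b where "en e = {a, b}" by (auto simp: card_2_iff)
      then show ?thesis using that by (cases "x = a") auto
    qed
    have all: "e \<in> L" if "e \<in> K" "x \<in> en e" "(u, x) \<in> R\<^sup>*" for e x
    proof -
      have "\<exists>y. en e = {x, y}" using other that by blast
      then obtain y where y: "en e = {x, y}" by blast
      then have "(x, y) \<in> R" using that by (auto simp: R_def)
      then show ?thesis using that y by (auto simp: L_def)
    qed
    have "edges_at en L x = (if (u, x) \<in> R\<^sup>* then edges_at en K x else {})" for x
      using all by (auto simp: edges_at_def L_def)
    then have "card (edges_at en L x) \<noteq> 1" for x
      using leafless by simp
    moreover have "L \<noteq> {}"
      using u all by (auto simp: V_def)
    ultimately have "P L"
      using KS by (auto simp: P_def L_def)
    then have "L = K"
      by (intro subK) (auto simp: L_def)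
    then show ?thesis
      using v by (auto simp: V_def L_def)
  qed
  show thesis
  proof (rule that[OF KS])
    have "V \<noteq> {}"
      using le e finK by auto
    then show "is_cycle \<lparr>mverts = \<Union>(en ` K), medges = K, ends = en\<rparr>"
      using finK finV conn card2 KS deg2
      unfolding V_def R_def
      by (auto simp: is_cycle_def multigraph_def mconnected_def mdegree_def edges_at_def)
  qed
qed

section \<open>Flows that differ on a set of small degrees\<close>

text \<open>
  The net outflow at a vertex over an arbitrary edge set, so that the contributions of \<open>H\<close> and of
  the other edges of \<open>G\<close> can be told apart.
\<close>

definition net :: "('v, 'e) pre_digraph \<Rightarrow> 'e set \<Rightarrow> ('e \<Rightarrow> 'a::ab_group_add) \<Rightarrow> 'v \<Rightarrow> 'a" where
  "net D S f v = (\<Sum>e\<in>{e \<in> S. tail D e = v}. f e) - (\<Sum>e\<in>{e \<in> S. head D e = v}. f e)"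

lemma net_cong:
  "(\<And>e. e \<in> S \<Longrightarrow> tail D e = v \<or> head D e = v \<Longrightarrow> f e = g e) \<Longrightarrow> net D S f v = net D S g v"
  unfolding net_def by (intro arg_cong2[where f = "(-)"] sum.cong) auto

lemma net_Un_disjoint:
  assumes "finite S" "finite T" "S \<inter> T = {}"
  shows "net D (S \<union> T) f v = net D S f v + net D T f v"
proof -
  have "{e \<in> S \<union> T. Q e} = {e \<in> S. Q e} \<union> {e \<in> T. Q e}" for Q
    by blast
  then have "(\<Sum>e\<in>{e \<in> S \<union> T. Q e}. f e) = (\<Sum>e\<in>{e \<in> S. Q e}. f e) + (\<Sum>e\<in>{e \<in> T. Q e}. f e)" for Q
    using assms by (simp only:) (intro sum.union_disjoint, auto)
  then show ?thesis
    by (simp add: net_def)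
qed

lemma sum_net_eq_0:
  assumes "finite S" "finite V" "tail D ` S \<subseteq> V" "head D ` S \<subseteq> V"
  shows "(\<Sum>v\<in>V. net D S f v) = 0"
  using assms by (simp add: net_def sum_subtractf sum.group)

lemma orientation_ends:
  "orientation G D \<Longrightarrow> e \<in> medges G \<Longrightarrow> ends G e = {tail D e, head D e}"
  by (simp add: orientation_def)

lemma orientation_tail_head:
  assumes "multigraph G" "orientation G D" "e \<in> medges G"
  shows "tail D e \<in> mverts G" "head D e \<in> mverts G" "tail D e \<noteq> head D e"
proof -
  have "card {tail D e, head D e} = 2" "{tail D e, head D e} \<subseteq> mverts G"
    using assms unfolding multigraph_def orientation_def by auto
  then show "tail D e \<in> mverts G" "head D e \<in> mverts G" "tail D e \<noteq> head D e"
    by auto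
qed

lemma flows_iff:
  assumes "orientation G D"
  shows "f \<in> flows G D \<beta> \<longleftrightarrow>
    f \<in> medges G \<rightarrow>\<^sub>E (UNIV - {0}) \<and> (\<forall>v\<in>mverts G. net D (medges G) f v = \<beta> v)"
proof -
  have "arcs D = medges G"
    using assms by (simp add: orientation_def)
  then show ?thesis
    by (simp add: flows_def net_def out_arcs_def in_arcs_def)
qed

lemma flow_sum_boundary:
  assumes "multigraph G" "orientation G D"
  shows "(\<Sum>v\<in>mverts G. net D (medges G) f v) = 0"
  using assms orientation_tail_head[OF assms] by (intro sum_net_eq_0) (auto simp: multigraph_def)

text \<open>
  Net outflows sum to zero, as does the boundary, so the condition at one vertex follows from the
  others. This is what makes the contracted vertex, and the exempt vertex of the criterion below,
  harmless.
\<close>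

lemma flowI_all_but_one:
  assumes G: "multigraph G" "orientation G D" and \<beta>: "boundary G \<beta>"
    and f: "f \<in> medges G \<rightarrow>\<^sub>E (UNIV - {0})"
    and eq: "\<And>v. v \<in> mverts G \<Longrightarrow> v \<noteq> z \<Longrightarrow> net D (medges G) f v = \<beta> v"
  shows "f \<in> flows G D \<beta>"
proof -
  have "net D (medges G) f z = \<beta> z" if z: "z \<in> mverts G"
  proof -
    have fin: "finite (mverts G)" using G by (simp add: multigraph_def)
    have "net D (medges G) f z + (\<Sum>v\<in>mverts G - {z}. net D (medges G) f v) = 0"
      using flow_sum_boundary[OF G, of f] by (simp add: sum.remove[OF fin z])
    moreover have "\<beta> z + (\<Sum>v\<in>mverts G - {z}. \<beta> v) = 0"
      using \<beta> by (simp add: boundary_def sum.remove[OF fin z])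
    moreover have "(\<Sum>v\<in>mverts G - {z}. net D (medges G) f v) = (\<Sum>v\<in>mverts G - {z}. \<beta> v)"
      using eq by (intro sum.cong) auto
    ultimately show ?thesis by (metis add_right_cancel)
  qed
  then show ?thesis
    using f eq by (auto simp: flows_iff[OF G(2)])
qed

lemma flow_boundary:
  assumes "multigraph G" "orientation G D" "f \<in> flows G D \<beta>"
  shows "boundary G \<beta>"
proof -
  have "(\<Sum>v\<in>mverts G. \<beta> v) = (\<Sum>v\<in>mverts G. net D (medges G) f v)"
    using assms(3) by (intro sum.cong) (auto simp: flows_iff[OF assms(2)])
  then show ?thesis
    using flow_sum_boundary[OF assms(1,2), of f] by (simp add: boundary_def)
qed

text \<open>
  If two flows differed on a single edge at \<open>v\<close>, their net outflows at \<open>v\<close> would differ.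
\<close>

lemma flow_difference_leafless:
  assumes G: "multigraph G" "orientation G D"
    and f: "f \<in> flows G D \<beta>" and g: "g \<in> flows G D \<beta>"
  shows "card (edges_at (ends G) {e \<in> medges G. f e \<noteq> g e} v) \<noteq> 1"
proof
  let ?E = "medges G" let ?S = "{e \<in> ?E. f e \<noteq> g e}"
  assume "card (edges_at (ends G) ?S v) = 1"
  then obtain e where e: "edges_at (ends G) ?S v = {e}"
    by (meson card_1_singletonE)
  then have eE: "e \<in> ?E" "f e \<noteq> g e" "v \<in> ends G e"
    by (auto simp: edges_at_def)
  have fin: "finite ?E" using G by (simp add: multigraph_def)
  have vV: "v \<in> mverts G" using eE G by (auto simp: multigraph_def)
  have split: "net D ?E h v = net D (?E - {e}) h v + net D {e} h v" for h :: "'b \<Rightarrow> 'c"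
    using net_Un_disjoint[of "?E - {e}" "{e}" D h v] fin eE by (simp add: insert_absorb)
  have "net D (?E - {e}) f v = net D (?E - {e}) g v"
  proof (rule net_cong)
    fix e' assume *: "e' \<in> ?E - {e}" "tail D e' = v \<or> head D e' = v"
    then have "v \<in> ends G e'" using orientation_ends[OF G(2), of e'] by auto
    then show "f e' = g e'"
      using e * unfolding edges_at_def by blast
  qed
  moreover have "net D ?E f v = net D ?E g v"
    using f g vV by (simp add: flows_iff[OF G(2)])
  ultimately have "net D {e} f v = net D {e} g v"
    by (simp add: split)
  moreover have "{e' \<in> {e}. Q e'} = (if Q e then {e} else {})" for Q
    by auto
  moreover have "(tail D e = v) \<noteq> (head D e = v)"
    using orientation_ends[OF G(2) eE(1)] orientation_tail_head[OF G eE(1)] eE(3) by auto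
  ultimately show False
    using eE(2) by (auto simp: net_def split: if_splits)
qed

text \<open>
  The difference set \<open>S\<close> is leafless, so it contains a cycle \<open>K\<close>. At a vertex \<open>v \<noteq> z\<close> of the
  cycle, \<open>K\<close> already has two edges, so it contains all edges of \<open>S\<close> at \<open>v\<close>. Hence the function that
  is \<open>g\<close> on \<open>K\<close> and \<open>f\<close> elsewhere looks like \<open>g\<close> around each vertex of \<open>K\<close> other than \<open>z\<close> and
  like \<open>f\<close> around each vertex off \<open>K\<close>: it is again a flow, it is adjacent to \<open>f\<close>, and it differs
  from \<open>g\<close> on fewer edges. It is nowhere zero because all its values are values of \<open>f\<close> or \<open>g\<close>.
\<close>

lemma flows_equivalent_if_difference_degree_le_2:
  assumes G: "multigraph G" "orientation G D"
    and f: "f \<in> flows G D \<beta>" and g: "g \<in> flows G D \<beta>"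
    and deg: "\<And>v. v \<in> mverts G \<Longrightarrow> v \<noteq> z \<Longrightarrow>
      card (edges_at (ends G) {e \<in> medges G. f e \<noteq> g e} v) \<le> 2"
  shows "(f, g) \<in> (flow_adjacent G D \<beta>)\<^sup>*"
  using f deg
proof (induction "card {e \<in> medges G. f e \<noteq> g e}" arbitrary: f rule: less_induct)
  case (less f)
  let ?E = "medges G" let ?S = "{e \<in> ?E. f e \<noteq> g e}"
  have fin: "finite ?E" using G by (simp add: multigraph_def)
  have fE: "f \<in> ?E \<rightarrow>\<^sub>E (UNIV - {0})" and gE: "g \<in> ?E \<rightarrow>\<^sub>E (UNIV - {0})"
    using less.prems(1) g by (auto simp: flows_iff[OF G(2)])
  show ?case
  proof (cases "?S = {}")
    case True
    then have "f = g" using fE gE by (intro PiE_ext[of f ?E _ g]) auto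
    then show ?thesis by simp
  next
    case False
    obtain K where K: "K \<subseteq> ?S" "K \<noteq> {}"
      and cyc: "is_cycle \<lparr>mverts = \<Union>(ends G ` K), medges = K, ends = ends G\<rparr>" (is "is_cycle ?C")
    proof (rule leafless_contains_cycle[of ?S "ends G"])
      show "card (edges_at (ends G) ?S v) \<noteq> 1" for v
        by (rule flow_difference_leafless[OF G less.prems(1) g])
    qed (use fin False G in \<open>auto simp: multigraph_def\<close>)
    have sub: "msubgraph ?C G"
      using K cyc G unfolding msubgraph_def is_cycle_def by (auto simp: multigraph_def)
    define h where "h = (\<lambda>e. if e \<in> K then g e else f e)"
    have hE: "h \<in> ?E \<rightarrow>\<^sub>E (UNIV - {0})"
      using fE gE K by (auto simp: h_def PiE_iff extensional_def)
    have h: "h \<in> flows G D \<beta>"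
    proof (rule flowI_all_but_one[OF G flow_boundary[OF G g] hE, where z = z])
      fix v assume v: "v \<in> mverts G" "v \<noteq> z"
      have at: "v \<in> ends G e" if "e \<in> ?E" "tail D e = v \<or> head D e = v" for e
        using orientation_ends[OF G(2)] that by auto
      show "net D ?E h v = \<beta> v"
      proof (cases "v \<in> \<Union>(ends G ` K)")
        case True
        then have "card (edges_at (ends G) K v) = 2"
          using cyc by (auto simp: is_cycle_def mdegree_def edges_at_def)
        then have "edges_at (ends G) K v = edges_at (ends G) ?S v"
          using less.prems(2)[OF v] K fin
          by (intro card_seteq) (auto intro: edges_at_mono simp: edges_at_def)
        then have "net D ?E h v = net D ?E g v"
          using at by (intro net_cong) (auto simp: h_def edges_at_def)
        then show ?thesis using g v by (simp add: flows_iff[OF G(2)])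
      next
        case False
        then have "net D ?E h v = net D ?E f v"
          using at by (intro net_cong) (auto simp: h_def)
        then show ?thesis using less.prems(1) v by (simp add: flows_iff[OF G(2)])
      qed
    qed
    have "(f, h) \<in> flow_adjacent G D \<beta>"
      unfolding flow_adjacent_def using less.prems(1) h sub cyc
      by (auto simp: h_def intro!: exI[of _ ?C])
    moreover have "(h, g) \<in> (flow_adjacent G D \<beta>)\<^sup>*"
    proof (rule less.hyps[OF _ h])
      have "{e \<in> ?E. h e \<noteq> g e} = ?S - K"
        by (auto simp: h_def)
      moreover have "card (?S - K) < card ?S"
        using K fin by (intro psubset_card_mono) auto
      ultimately show "card {e \<in> ?E. h e \<noteq> g e} < card ?S" by simp
      fix v assume v: "v \<in> mverts G" "v \<noteq> z"
      have "card (edges_at (ends G) {e \<in> ?E. h e \<noteq> g e} v) \<le> card (edges_at (ends G) ?S v)"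
        using fin by (intro card_mono edges_at_mono) (auto simp: h_def)
      also have "\<dots> \<le> 2" by (rule less.prems(2)[OF v])
      finally show "card (edges_at (ends G) {e \<in> ?E. h e \<noteq> g e} v) \<le> 2" .
    qed
    ultimately show ?thesis by simp
  qed
qed

section \<open>Degrees of cycles and paths\<close>

lemma cycle_degree_le_2:
  assumes "msubgraph C G" "is_cycle C" "S \<subseteq> medges C"
  shows "card (edges_at (ends G) S v) \<le> 2"
proof -
  have C: "multigraph C" "\<And>e. e \<in> medges C \<Longrightarrow> ends C e = ends G e"
    using assms by (auto simp: msubgraph_def)
  have sub: "edges_at (ends G) S v \<subseteq> {e \<in> medges C. v \<in> ends C e}"
    using assms(3) C(2) by (auto simp: edges_at_def)
  show ?thesis
  proof (cases "v \<in> mverts C")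
    case True
    then have "card {e \<in> medges C. v \<in> ends C e} = 2"
      using assms(2) by (simp add: is_cycle_def mdegree_def)
    moreover have "finite {e \<in> medges C. v \<in> ends C e}"
      using C(1) by (simp add: multigraph_def)
    ultimately show ?thesis
      using card_mono[OF _ sub] by simp
  next
    case False
    then have "{e \<in> medges C. v \<in> ends C e} = {}"
      using C(1) by (auto simp: multigraph_def)
    then have "edges_at (ends G) S v = {}" using sub by blast
    then show ?thesis by simp
  qed
qed

text \<open>
  The vertices of a path are distinct, so an edge at the \<open>j\<close>-th vertex is the edge number \<open>j\<close> or
  \<open>j - 1\<close>, and at each end only one of the two exists.
\<close>

lemma path_degree:
  assumes "is_path G u vs es v"
  shows "card (edges_at (ends G) (set es) x) \<le> (if x = u \<or> x = v then 1 else 2)"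
proof (cases "x \<in> set vs")
  case True
  let ?n = "length es"
  have len: "length vs = Suc ?n" and dist: "distinct vs"
    and uv: "hd vs = u" "last vs = v"
    and en: "\<And>i. i < ?n \<Longrightarrow> ends G (es ! i) = {vs ! i, vs ! Suc i}"
    using assms by (auto simp: is_path_def)
  obtain j where j: "j \<le> ?n" "x = vs ! j"
    using True len by (auto simp: in_set_conv_nth less_Suc_eq_le)
  have idx: "(vs ! i = x) = (i = j)" if "i \<le> ?n" for i
    using that j len dist by (simp add: nth_eq_iff_index_eq)
  let ?J = "{i. i < ?n \<and> (i = j \<or> Suc i = j)}"
  have "edges_at (ends G) (set es) x \<subseteq> (!) es ` ?J"
  proof
    fix e assume "e \<in> edges_at (ends G) (set es) x"
    then obtain i where i: "i < ?n" "e = es ! i" "x \<in> ends G (es ! i)"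
      unfolding edges_at_def in_set_conv_nth by blast
    then have "vs ! i = x \<or> vs ! Suc i = x" using en[OF i(1)] by auto
    then have "i \<in> ?J" using i(1) idx[of i] idx[of "Suc i"] by simp
    then show "e \<in> (!) es ` ?J" using i(2) by blast
  qed
  moreover have "finite ?J" by simp
  ultimately have le: "card (edges_at (ends G) (set es) x) \<le> card ?J"
    using surj_card_le by blast
  have "vs \<noteq> []" using len by auto
  then have "hd vs = vs ! 0" "last vs = vs ! ?n"
    using len by (simp_all add: hd_conv_nth last_conv_nth)
  then have ends: "j = 0 \<or> j = ?n" if "x = u \<or> x = v"
    using that uv idx[of 0] idx[of ?n] by auto
  show ?thesis
  proof (cases "x = u \<or> x = v")
    case True
    then have "?J \<subseteq> {if j = 0 then 0 else ?n - 1}"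
      using ends by auto
    then have "card ?J \<le> 1"
      using card_mono[of "{if j = 0 then 0 else ?n - 1}" ?J] by simp
    then show ?thesis using le True by simp
  next
    case False
    have "?J \<subseteq> {j, j - 1}" by auto
    then have "card ?J \<le> card {j, j - 1}" by (intro card_mono) auto
    also have "\<dots> \<le> 2" by (simp add: card_insert_if)
    finally show ?thesis using le False by simp
  qed
next
  case False
  have "x \<notin> ends G e" if "e \<in> set es" for e
  proof -
    obtain i where i: "i < length es" "e = es ! i"
      using \<open>e \<in> set es\<close> by (auto simp: in_set_conv_nth)
    then have "ends G e = {vs ! i, vs ! Suc i}" "vs ! i \<in> set vs" "vs ! Suc i \<in> set vs"
      using assms by (auto simp: is_path_def)
    then show ?thesis using False by auto
  qed
  then have "edges_at (ends G) (set es) x = {}"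
    by (auto simp: edges_at_def)
  then show ?thesis by simp
qed

section \<open>Flows of a graph and of its contraction\<close>

lemma multigraph_contract:
  assumes "multigraph G"
  shows "multigraph (contract G H)"
  using assms by (auto simp: multigraph_def contract_def)

text \<open>
  Equivalence of flows is studied for orientations of \<open>G\<close> and \<open>G/H\<close> that correspond to each other,
  so that flows of \<open>G/H\<close> are restrictions of flows of \<open>G\<close> with unchanged signs.
\<close>

locale contraction =
  fixes G H :: "('v, 'e) mgraph" and D :: "('v, 'e) pre_digraph"
    and D' :: "('v option, 'e) pre_digraph"
  assumes G: "multigraph G" and HG: "msubgraph H G"
    and D: "orientation G D" and D': "orientation (contract G H) D'"
    and compatible: "e \<in> medges (contract G H) \<Longrightarrow>
      tail D' e = contract_vertex H (tail D e) \<and> head D' e = contract_vertex H (head D e)"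
begin

text \<open>
  The outer edges include those that become loops in \<open>G/H\<close> and are deleted there: the edges of
  \<open>G/H\<close> may form a proper subset.
\<close>

abbreviation outer :: "'e set" where
  "outer \<equiv> medges G - medges H"

abbreviation DH :: "('v, 'e) pre_digraph" where
  "DH \<equiv> D\<lparr>verts := mverts H, arcs := medges H\<rparr>"

lemma finG: "finite (medges G)" "finite (mverts G)"
  using G by (auto simp: multigraph_def)

lemma H: "multigraph H" "mverts H \<subseteq> mverts G" "medges H \<subseteq> medges G"
  "e \<in> medges H \<Longrightarrow> ends H e = ends G e"
  using HG by (auto simp: msubgraph_def)

lemma finH: "finite (medges H)" "finite (mverts H)"
  using H(1) by (auto simp: multigraph_def)

lemma DH: "orientation H DH"
  using D H by (auto simp: orientation_def)

lemma net_DH [simp]: "net DH S f v = net D S f v"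
  by (simp add: net_def)

lemma contract_edges: "medges (contract G H) \<subseteq> outer"
  by (auto simp: contract_def)

lemma ends_contract: "ends (contract G H) e = contract_vertex H ` ends G e"
  by (simp add: contract_def)

lemma edge_off_H:
  assumes "e \<in> medges G" "v \<in> ends G e" "v \<notin> mverts H"
  shows "e \<in> medges (contract G H)"
proof -
  obtain w where w: "ends G e = {v, w}" "w \<noteq> v"
  proof (cases "v = tail D e")
    case True
    then show ?thesis
      using that[of "head D e"] orientation_ends[OF D assms(1)]
        orientation_tail_head(3)[OF G D assms(1)] by simp
  next
    case False
    then have "v = head D e"
      using assms(2) orientation_ends[OF D assms(1)] by simp
    then show ?thesis
      using that[of "tail D e"] orientation_ends[OF D assms(1)] False by (simp add: insert_commute)
  qed
  have "ends H e' \<subseteq> mverts H" if "e' \<in> medges H" for e'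
    using H(1) that unfolding multigraph_def by blast
  then have "e \<notin> medges H"
    using H(4)[of e] assms(2,3) by auto
  moreover have "contract_vertex H v = Some v" "contract_vertex H w \<noteq> Some v"
    using assms(3) w(2) by (auto simp: contract_vertex_def)
  then have "card (contract_vertex H ` ends G e) = 2"
    unfolding w(1) by simp
  ultimately show ?thesis
    using assms(1) by (simp add: contract_def)
qed

lemma net_split: "net D (medges G) f v = net D outer f v + net D (medges H) f v"
proof -
  have "outer \<union> medges H = medges G" using H(3) by blast
  then show ?thesis
    using net_Un_disjoint[of outer "medges H" D f v] finG finH by auto
qed

lemma net_H_eq_0:
  assumes "v \<notin> mverts H"
  shows "net D (medges H) f v = 0"
proof -
  have "{e \<in> medges H. tail D e = v} = {}" "{e \<in> medges H. head D e = v} = {}"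
    using orientation_tail_head[OF H(1) DH] assms by auto
  then show ?thesis by (simp only: net_def sum.empty diff_self)
qed

lemma net_off_H: "v \<notin> mverts H \<Longrightarrow> net D (medges G) f v = net D outer f v"
  by (simp add: net_split net_H_eq_0)

lemma net_contract:
  assumes "v \<notin> mverts H"
  shows "net D' (medges (contract G H)) f (Some v) = net D outer f v"
proof -
  let ?E' = "medges (contract G H)"
  have "(contract_vertex H w = Some v) = (w = v)" for w
    using assms by (auto simp: contract_vertex_def)
  then have "{e \<in> ?E'. tail D' e = Some v} = {e \<in> outer. tail D e = v}"
    "{e \<in> ?E'. head D' e = Some v} = {e \<in> outer. head D e = v}"
    using compatible contract_edges edge_off_H[of _ v] assms orientation_ends[OF D] by auto
  then show ?thesis by (simp add: net_def)
qed

lemma contract_flow_iff: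
  "f \<in> flows (contract G H) D' (\<lambda>_. 0) \<longleftrightarrow>
    f \<in> medges (contract G H) \<rightarrow>\<^sub>E (UNIV - {0}) \<and> (\<forall>v\<in>mverts G - mverts H. net D outer f v = 0)"
    (is "?L \<longleftrightarrow> ?R")
proof
  assume f: ?L
  have "net D outer f v = 0" if v: "v \<in> mverts G - mverts H" for v
  proof -
    have "contract_vertex H v = Some v" using v by (simp add: contract_vertex_def)
    then have "Some v \<in> mverts (contract G H)"
      using v unfolding contract_def by (metis DiffD1 image_eqI select_convs(1))
    then show ?thesis
      using f v net_contract[of v f] by (simp add: flows_iff[OF D'])
  qed
  then show ?R
    using f by (simp add: flows_iff[OF D'])
next
  assume f: ?R
  show ?L
  proof (rule flowI_all_but_one[OF multigraph_contract[OF G] D', where z = None])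
    fix x assume "x \<in> mverts (contract G H)" "x \<noteq> None"
    then obtain v where "x = Some v" "v \<in> mverts G - mverts H"
      by (auto simp: contract_def contract_vertex_def split: if_splits)
    then show "net D' (medges (contract G H)) f x = 0"
      using f by (simp add: net_contract)
  qed (use f in \<open>auto simp: boundary_def\<close>)
qed

text \<open>
  An outer edge that is not an edge of \<open>G/H\<close> has both ends in \<open>H\<close>, so its value does not
  matter at the other vertices.
\<close>

lemma net_outer_cong:
  assumes "v \<notin> mverts H" "\<And>e. e \<in> medges (contract G H) \<Longrightarrow> f e = g e"
  shows "net D outer f v = net D outer g v"
  using assms edge_off_H[of _ v] orientation_ends[OF D] by (intro net_cong) auto

lemma restrict_flow:
  assumes F: "F \<in> flows G D (\<lambda>_. 0)"
  shows "restrict F (medges (contract G H)) \<in> flows (contract G H) D' (\<lambda>_. 0)"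
proof -
  have "net D outer (restrict F (medges (contract G H))) v = 0" if "v \<in> mverts G - mverts H" for v
  proof -
    have "net D outer (restrict F (medges (contract G H))) v = net D outer F v"
      using that by (intro net_outer_cong) auto
    also have "\<dots> = 0"
      using F that by (simp add: net_off_H[symmetric] flows_iff[OF D])
    finally show ?thesis .
  qed
  moreover have "F e \<noteq> 0" if "e \<in> medges (contract G H)" for e
    using F that contract_edges by (auto simp: flows_iff[OF D])
  ultimately show ?thesis
    by (simp add: contract_flow_iff restrict_PiE_iff)
qed

definition glue :: "('e \<Rightarrow> 'a) \<Rightarrow> ('e \<Rightarrow> 'a) \<Rightarrow> 'e \<Rightarrow> 'a" where
  "glue p h = (\<lambda>e\<in>medges G. if e \<in> medges H then h e else p e)"

text \<open>
  The boundary that a flow on \<open>H\<close> must have in order to complete the outer values \<open>p\<close> to a flow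
  of \<open>G\<close> with zero boundary.
\<close>

abbreviation demand :: "('e \<Rightarrow> 'a::ab_group_add) \<Rightarrow> 'v \<Rightarrow> 'a" where
  "demand p \<equiv> \<lambda>v. - net D outer p v"

lemma glue_flow:
  assumes p: "\<And>e. e \<in> outer \<Longrightarrow> p e \<noteq> 0"
    and bal: "\<And>v. v \<in> mverts G - mverts H \<Longrightarrow> net D outer p v = 0"
    and h: "h \<in> flows H DH (demand p)"
  shows "glue p h \<in> flows G D (\<lambda>_. 0)"
proof -
  have "h e \<noteq> 0" if "e \<in> medges H" for e
    using h that by (auto simp: flows_iff[OF DH])
  then have "glue p h \<in> medges G \<rightarrow>\<^sub>E (UNIV - {0})"
    using p by (simp add: glue_def restrict_PiE_iff)
  moreover have "net D (medges G) (glue p h) v = 0" if "v \<in> mverts G" for v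
  proof -
    have "net D outer (glue p h) v = net D outer p v"
      by (intro net_cong) (auto simp: glue_def)
    moreover have "net D (medges H) (glue p h) v = net D (medges H) h v"
      using H(3) by (intro net_cong) (auto simp: glue_def)
    ultimately show ?thesis
      using that bal h by (cases "v \<in> mverts H") (auto simp: net_split net_H_eq_0 flows_iff[OF DH])
  qed
  ultimately show ?thesis by (simp add: flows_iff[OF D])
qed

lemma boundary_demand:
  assumes "\<And>v. v \<in> mverts G - mverts H \<Longrightarrow> net D outer p v = 0"
  shows "boundary H (demand p)"
proof -
  have "(\<Sum>v\<in>mverts H. net D outer p v) = (\<Sum>v\<in>mverts G. net D outer p v)"
    using assms finG H(2) by (intro sum.mono_neutral_left) auto
  also have "\<dots> = 0"
    using orientation_tail_head[OF G D] finG by (intro sum_net_eq_0) auto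
  finally show ?thesis by (simp add: boundary_def sum_negf)
qed

lemma flow_outer:
  assumes "F \<in> flows G D (\<lambda>_. 0)"
  shows "e \<in> outer \<Longrightarrow> F e \<noteq> 0" "v \<in> mverts G - mverts H \<Longrightarrow> net D outer F v = 0"
  using assms by (auto simp: flows_iff[OF D] net_off_H[symmetric])

lemma restrict_H_flow:
  assumes F: "F \<in> flows G D (\<lambda>_. 0)"
  shows "restrict F (medges H) \<in> flows H DH (demand F)"
proof -
  have "net D (medges H) (restrict F (medges H)) v = - net D outer F v" if "v \<in> mverts H" for v
  proof -
    have "net D (medges H) (restrict F (medges H)) v = net D (medges H) F v"
      by (intro net_cong) auto
    moreover have "net D (medges G) F v = 0"
      using F that H(2) by (auto simp: flows_iff[OF D])
    ultimately show ?thesis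
      by (simp add: net_split eq_neg_iff_add_eq_0 add.commute)
  qed
  moreover have "F e \<noteq> 0" if "e \<in> medges H" for e
    using F that H(3) by (auto simp: flows_iff[OF D])
  ultimately show ?thesis
    by (simp add: flows_iff[OF DH] restrict_PiE_iff)
qed

section \<open>From the graph to its contraction\<close>

text \<open>
  Edges that are loops in \<open>G/H\<close> may carry any nonzero value \<open>a\<close>; \<open>A\<close>-connectedness then supplies
  values on \<open>H\<close> meeting the resulting demand.
\<close>

lemma contract_flow_lifts:
  assumes conn: "group_connected TYPE('a::ab_group_add) H"
    and f: "f \<in> flows (contract G H) D' (\<lambda>_. 0 :: 'a)" and a: "a \<noteq> (0 :: 'a)"
  obtains F where "F \<in> flows G D (\<lambda>_. 0)" "restrict F (medges (contract G H)) = f"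
proof -
  let ?E' = "medges (contract G H)"
  define p where "p e = (if e \<in> ?E' then f e else a)" for e
  have p: "p e \<noteq> 0" for e
    using f a by (auto simp: p_def contract_flow_iff)
  have bal: "net D outer p v = 0" if "v \<in> mverts G - mverts H" for v
  proof -
    have "net D outer p v = net D outer f v"
      using that by (intro net_outer_cong) (auto simp: p_def)
    then show ?thesis using f that by (simp add: contract_flow_iff)
  qed
  obtain h where h: "h \<in> flows H DH (demand p)"
    using conn boundary_demand[OF bal] DH unfolding group_connected_def by blast
  have "restrict (glue p h) ?E' = f"
  proof
    show "restrict (glue p h) ?E' e = f e" for e
      using f contract_edges
      by (cases "e \<in> ?E'") (auto simp: glue_def p_def contract_flow_iff PiE_iff extensional_def)
  qed
  with glue_flow[OF p bal h] that show thesis by blast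
qed

text \<open>
  Off the contracted vertex \<open>None\<close>, degrees in \<open>G/H\<close> are degrees in \<open>G\<close>, where the difference lies
  on a cycle. The image of that cycle may visit \<open>None\<close> any number of times, whence \<open>z = None\<close>.
\<close>

lemma contract_adjacent:
  assumes "(F1, F2) \<in> flow_adjacent G D (\<lambda>_. 0)"
  shows "(restrict F1 (medges (contract G H)), restrict F2 (medges (contract G H)))
    \<in> (flow_adjacent (contract G H) D' (\<lambda>_. 0))\<^sup>*"
proof -
  let ?E' = "medges (contract G H)"
  let ?S = "{e \<in> ?E'. restrict F1 ?E' e \<noteq> restrict F2 ?E' e}"
  obtain C where F: "F1 \<in> flows G D (\<lambda>_. 0)" "F2 \<in> flows G D (\<lambda>_. 0)"
    and C: "msubgraph C G" "is_cycle C" "\<forall>e\<in>medges G - medges C. F1 e = F2 e"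
    using assms by (auto simp: flow_adjacent_def)
  have S: "?S \<subseteq> medges C"
    using C(3) contract_edges by auto
  show ?thesis
  proof (rule flows_equivalent_if_difference_degree_le_2[OF multigraph_contract[OF G] D'
          restrict_flow[OF F(1)] restrict_flow[OF F(2)], where z = None])
    fix x assume "x \<in> mverts (contract G H)" "x \<noteq> None"
    then obtain v where v: "x = Some v" "v \<notin> mverts H"
      by (auto simp: contract_def contract_vertex_def split: if_splits)
    have "edges_at (ends (contract G H)) ?S x = edges_at (ends G) ?S v"
      using v by (auto simp: edges_at_def ends_contract contract_vertex_def image_iff split: if_splits)
    then show "card (edges_at (ends (contract G H)) ?S x) \<le> 2"
      using cycle_degree_le_2[OF C(1,2) S] by simp
  qed
qed

lemma contract_flow_connected:
  assumes conn: "group_connected TYPE('a::ab_group_add) H"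
    and G_conn: "group_flow_connected TYPE('a) G"
    and f: "f \<in> flows (contract G H) D' (\<lambda>_. 0 :: 'a)" and g: "g \<in> flows (contract G H) D' (\<lambda>_. 0)"
  shows "(f, g) \<in> (flow_adjacent (contract G H) D' (\<lambda>_. 0))\<^sup>*"
proof (cases "\<exists>a::'a. a \<noteq> 0")
  case True
  let ?E' = "medges (contract G H)"
  from True obtain a :: 'a where a: "a \<noteq> 0" by blast
  obtain F1 where F1: "F1 \<in> flows G D (\<lambda>_. 0)" "restrict F1 ?E' = f"
    using contract_flow_lifts[OF conn f a] .
  obtain F2 where F2: "F2 \<in> flows G D (\<lambda>_. 0)" "restrict F2 ?E' = g"
    using contract_flow_lifts[OF conn g a] .
  have "(F1, F2) \<in> (flow_adjacent G D (\<lambda>_. 0))\<^sup>*"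
    using G_conn D F1 F2 by (auto simp: group_flow_connected_def flow_connected_def)
  then have "(restrict F1 ?E', restrict F2 ?E') \<in> (flow_adjacent (contract G H) D' (\<lambda>_. 0))\<^sup>*"
  proof induction
    case (step F F')
    show ?case
      by (rule rtrancl_trans[OF step.IH contract_adjacent[OF step.hyps(2)]])
  qed (rule rtrancl_refl)
  then show ?thesis using F1 F2 by simp
next
  \<comment> \<open>Over the trivial group a flow can exist only if there are no edges.\<close>
  case False
  then have "f = g"
    using f g unfolding contract_flow_iff by (intro PiE_ext[of f _ _ g]) auto
  then show ?thesis by simp
qed

section \<open>From the contraction to the graph\<close>

text \<open>
  Both flows restrict to flows of \<open>H\<close> with the boundary that the common outer values demand. A
  sequence of adjacent flows of \<open>H\<close> joining the restrictions becomes one in \<open>G\<close> once the outer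
  values are glued to each member, since a cycle of \<open>H\<close> is a cycle of \<open>G\<close>.
\<close>

lemma equivalent_if_equal_outer:
  assumes conn: "\<And>\<beta> :: 'v \<Rightarrow> 'a::ab_group_add. boundary H \<beta> \<Longrightarrow> flow_connected H \<beta>"
    and F1: "F1 \<in> flows G D (\<lambda>_. 0 :: 'a)" and F2: "F2 \<in> flows G D (\<lambda>_. 0)"
    and eq: "\<And>e. e \<in> outer \<Longrightarrow> F1 e = F2 e"
  shows "(F1, F2) \<in> (flow_adjacent G D (\<lambda>_. 0))\<^sup>*"
proof -
  let ?r = "\<lambda>F. restrict F (medges H)"
  have glue: "glue F1 (?r F) = F" if "F \<in> flows G D (\<lambda>_. 0)" "\<And>e. e \<in> outer \<Longrightarrow> F1 e = F e" for F
  proof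
    show "glue F1 (?r F) e = F e" for e
      using that by (cases "e \<in> medges G") (auto simp: glue_def flows_iff[OF D] PiE_iff extensional_def)
  qed
  have "net D outer F1 v = net D outer F2 v" for v
    using eq by (intro net_cong) auto
  then have "demand F1 = demand F2"
    by simp
  then have r: "?r F1 \<in> flows H DH (demand F1)" "?r F2 \<in> flows H DH (demand F1)"
    using restrict_H_flow[OF F1] restrict_H_flow[OF F2] by auto
  have "flow_connected H (demand F1)"
    using flow_outer[OF F1] by (intro conn boundary_demand) auto
  then have "(?r F1, ?r F2) \<in> (flow_adjacent H DH (demand F1))\<^sup>*"
    using DH r by (auto simp: flow_connected_def)
  then have "(glue F1 (?r F1), glue F1 (?r F2)) \<in> (flow_adjacent G D (\<lambda>_. 0))\<^sup>*"
  proof induction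
    case (step h h')
    then obtain C where h: "h \<in> flows H DH (demand F1)" "h' \<in> flows H DH (demand F1)"
      and C: "msubgraph C H" "is_cycle C" "\<forall>e\<in>medges H - medges C. h e = h' e"
      by (auto simp: flow_adjacent_def)
    have "msubgraph C G"
      using C(1) HG by (auto simp: msubgraph_def)
    moreover have "\<forall>e\<in>medges G - medges C. glue F1 h e = glue F1 h' e"
      using C(3) by (auto simp: glue_def)
    moreover have "glue F1 h \<in> flows G D (\<lambda>_. 0)" "glue F1 h' \<in> flows G D (\<lambda>_. 0)"
      using h flow_outer[OF F1] by (auto intro!: glue_flow)
    ultimately have "(glue F1 h, glue F1 h') \<in> flow_adjacent G D (\<lambda>_. 0)"
      using C(2) by (auto simp: flow_adjacent_def)
    then show ?case using step.IH by simp
  qed simp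
  then show ?thesis using glue[OF F1] glue[OF F2] eq by simp
qed

text \<open>
  Let \<open>W\<close> be the set of vertices of \<open>H\<close> at which the change from \<open>F\<close> to \<open>p\<close> alters the demand.
  Each of them meets \<open>T\<close>, so there are at most two; and there cannot be exactly one, since demands
  sum to zero. If \<open>W\<close> is empty, the values on \<open>H\<close> can stay. If \<open>W = {u, v}\<close>, convertibility
  yields flows \<open>h1\<close>, \<open>h2\<close> on \<open>H\<close> for the old and the new demand that differ on a path from \<open>u\<close> to
  \<open>v\<close>. First the values on \<open>H\<close> are changed to \<open>h1\<close> without touching the outer edges; then \<open>p\<close>
  and \<open>h2\<close> are put in place together. The second change happens on \<open>T\<close> and the path: \<open>u\<close> and
  \<open>v\<close> use up the two incidences of \<open>T\<close> with \<open>H\<close>, which leaves degree at most two everywhere.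
\<close>

lemma change_outer_values:
  assumes frc: "FRC TYPE('a::ab_group_add) H"
    and F: "F \<in> flows G D (\<lambda>_. 0 :: 'a)"
    and p: "\<And>e. e \<in> outer \<Longrightarrow> p e \<noteq> 0"
    and bal: "\<And>v. v \<in> mverts G - mverts H \<Longrightarrow> net D outer p v = 0"
    and T: "T = {e \<in> outer. F e \<noteq> p e}"
    and deg: "\<And>v. v \<in> mverts G - mverts H \<Longrightarrow> card (edges_at (ends G) T v) \<le> 2"
    and degH: "(\<Sum>v\<in>mverts H. card (edges_at (ends G) T v)) \<le> 2"
  obtains F' where "F' \<in> flows G D (\<lambda>_. 0)" "\<And>e. e \<in> outer \<Longrightarrow> F' e = p e"
    "(F, F') \<in> (flow_adjacent G D (\<lambda>_. 0))\<^sup>*"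
proof -
  have finT: "finite T" using T finG by simp
  have bF: "boundary H (demand F)" and bp: "boundary H (demand p)"
    using flow_outer[OF F] bal by (auto intro!: boundary_demand)
  have degH1: "card (edges_at (ends G) T v) \<le> 2" if "v \<in> mverts H" for v
    using member_le_sum[OF that, of "\<lambda>v. card (edges_at (ends G) T v)"] degH finH by simp
  define W where "W = {v \<in> mverts H. demand F v \<noteq> demand p v}"
  have W_T: "edges_at (ends G) T v \<noteq> {}" if "v \<in> W" for v
  proof
    assume "edges_at (ends G) T v = {}"
    then have "net D outer F v = net D outer p v"
      using T orientation_ends[OF D] by (intro net_cong) (auto simp: edges_at_def)
    then show False using that by (simp add: W_def)
  qed
  have W_pos: "1 \<le> card (edges_at (ends G) T v)" if "v \<in> W" for v
    using W_T[OF that] finT by (simp add: card_gt_0_iff Suc_le_eq)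
  have finW: "finite W" using finH by (simp add: W_def)
  have "card W = (\<Sum>v\<in>W. 1)" by simp
  also have "\<dots> \<le> (\<Sum>v\<in>W. card (edges_at (ends G) T v))"
    using W_pos by (intro sum_mono) auto
  also have "\<dots> \<le> (\<Sum>v\<in>mverts H. card (edges_at (ends G) T v))"
    using finH by (intro sum_mono2) (auto simp: W_def)
  finally have W_le: "card W \<le> 2" using degH by simp
  have W_ne: "card W \<noteq> 1"
  proof
    assume "card W = 1"
    then obtain w where w: "W = {w}" by (meson card_1_singletonE)
    have wH: "w \<in> mverts H" using w by (auto simp: W_def)
    have "(\<Sum>v\<in>mverts H - {w}. demand F v) = (\<Sum>v\<in>mverts H - {w}. demand p v)"
      using w by (intro sum.cong) (auto simp: W_def)
    moreover have "demand F w + (\<Sum>v\<in>mverts H - {w}. demand F v) = 0"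
      "demand p w + (\<Sum>v\<in>mverts H - {w}. demand p v) = 0"
      using bF bp unfolding boundary_def by (simp_all add: sum.remove[OF finH(2) wH])
    ultimately have "demand F w = demand p w" by (metis add_right_cancel)
    then show False using w by (auto simp: W_def)
  qed
  show thesis
  proof (cases "W = {}")
    case True
    have "restrict F (medges H) \<in> flows H DH (demand p)"
      using restrict_H_flow[OF F] True by (auto simp: flows_iff[OF DH] W_def)
    then have F': "glue p (restrict F (medges H)) \<in> flows G D (\<lambda>_. 0)" (is "?F' \<in> _")
      using p bal by (intro glue_flow) auto
    have dif: "{e \<in> medges G. F e \<noteq> ?F' e} = T"
      using T by (auto simp: glue_def)
    have "(F, ?F') \<in> (flow_adjacent G D (\<lambda>_. 0))\<^sup>*"
    proof (rule flows_equivalent_if_difference_degree_le_2[OF G D F F'])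
      show "card (edges_at (ends G) {e \<in> medges G. F e \<noteq> ?F' e} v) \<le> 2" if "v \<in> mverts G" for v
        using that deg[of v] degH1[of v] unfolding dif by auto
    qed
    moreover have "?F' e = p e" if "e \<in> outer" for e
      using that by (simp add: glue_def)
    ultimately show ?thesis using that F' by blast
  next
    case False
    then have "card W = 2"
      using W_ne W_le finW card_gt_0_iff[of W] by linarith
    then obtain u v where uv: "W = {u, v}" "u \<noteq> v"
      by (auto simp: card_2_iff)
    have uvH: "u \<in> mverts H" "v \<in> mverts H" using uv by (auto simp: W_def)
    have "differ_only_at H (demand F) (demand p) u v"
      using uv by (simp add: differ_only_at_def W_def)
    then have "flow_convertible H (demand F) (demand p) u v"
      using frc bF bp unfolding FRC_def by blast
    then obtain h1 h2 vs es where h: "h1 \<in> flows H DH (demand F)" "h2 \<in> flows H DH (demand p)"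
      and path: "is_path H u vs es v" and es: "{e \<in> medges H. h1 e \<noteq> h2 e} = set es"
      using DH unfolding flow_convertible_def by blast
    have F1: "glue F h1 \<in> flows G D (\<lambda>_. 0)" and F2: "glue p h2 \<in> flows G D (\<lambda>_. 0)"
      using h p bal flow_outer[OF F] by (auto intro!: glue_flow)
    have "(F, glue F h1) \<in> (flow_adjacent G D (\<lambda>_. 0))\<^sup>*"
      using frc by (intro equivalent_if_equal_outer[OF _ F F1]) (auto simp: FRC_def glue_def)
    also have "(glue F h1, glue p h2) \<in> (flow_adjacent G D (\<lambda>_. 0))\<^sup>*"
    proof (rule flows_equivalent_if_difference_degree_le_2[OF G D F1 F2])
      fix x assume x: "x \<in> mverts G"
      have "{e \<in> medges G. glue F h1 e \<noteq> glue p h2 e} = T \<union> set es"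
        using T es H(3) by (auto simp: glue_def)
      then have "edges_at (ends G) {e \<in> medges G. glue F h1 e \<noteq> glue p h2 e} x
          = edges_at (ends G) T x \<union> edges_at (ends G) (set es) x"
        by (auto simp: edges_at_def)
      then have le: "card (edges_at (ends G) {e \<in> medges G. glue F h1 e \<noteq> glue p h2 e} x)
          \<le> card (edges_at (ends G) T x) + card (edges_at (ends G) (set es) x)"
        using card_Un_le by simp
      have "edges_at (ends G) (set es) x = edges_at (ends H) (set es) x"
        using path H(4) by (auto simp: edges_at_def is_path_def)
      then have pd: "card (edges_at (ends G) (set es) x) \<le> (if x \<in> W then 1 else 2)"
        using path_degree[OF path, of x] uv by auto
      have sum: "(\<Sum>v\<in>insert x W. card (edges_at (ends G) T v)) \<le> 2" if "x \<in> mverts H"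
        using that uvH uv degH finH
        by (intro order.trans[OF sum_mono2 degH]) auto
      consider "x \<notin> mverts H" | "x \<in> W" | "x \<in> mverts H" "x \<notin> W" by blast
      then show "card (edges_at (ends G) {e \<in> medges G. glue F h1 e \<noteq> glue p h2 e} x) \<le> 2"
      proof cases
        case 1
        then have "edges_at (ends H) (set es) x = {}"
          using path H(1) by (auto simp: edges_at_def is_path_def multigraph_def)
        then show ?thesis
          using le deg[of x] x 1 \<open>edges_at (ends G) (set es) x = edges_at (ends H) (set es) x\<close> by simp
      next
        case 2
        then have "insert x W = {u, v}" "x \<in> mverts H" using uv uvH by auto
        then have "card (edges_at (ends G) T u) + card (edges_at (ends G) T v) \<le> 2"
          using sum uv by simp
        then have "card (edges_at (ends G) T x) \<le> 1"
          using W_pos[of u] W_pos[of v] 2 uv by auto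
        then show ?thesis using le pd 2 by simp
      next
        case 3
        then have "card (edges_at (ends G) T x)
            + (card (edges_at (ends G) T u) + card (edges_at (ends G) T v)) \<le> 2"
          using sum uv by simp
        then have "card (edges_at (ends G) T x) = 0"
          using W_pos[of u] W_pos[of v] uv by auto
        then show ?thesis using le pd 3 by simp
      qed
    qed
    finally have "(F, glue p h2) \<in> (flow_adjacent G D (\<lambda>_. 0))\<^sup>*" .
    moreover have "glue p h2 e = p e" if "e \<in> outer" for e
      using that by (simp add: glue_def)
    ultimately show ?thesis using that F2 by blast
  qed
qed

lemma sum_degree_H:
  assumes "T \<subseteq> medges G"
  shows "(\<Sum>v\<in>mverts H. card (edges_at (ends G) T v)) = (\<Sum>e\<in>T. card (ends G e \<inter> mverts H))"
proof (rule handshake)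
  show "finite T" using assms finG finite_subset by blast
  show "finite (ends G e)" if "e \<in> T" for e
    using that assms G finG by (meson finite_subset multigraph_def subsetD)
qed (rule finH)

text \<open>
  The two flows differ outside \<open>H\<close> only on edges with both ends in \<open>H\<close>. Changing the value of one
  such edge meets \<open>H\<close> exactly twice and is a case of the previous move, so they can be adjusted one
  after the other.
\<close>

lemma equivalent_if_equal_contract:
  assumes frc: "FRC TYPE('a::ab_group_add) H"
    and F1: "F1 \<in> flows G D (\<lambda>_. 0 :: 'a)" and F2: "F2 \<in> flows G D (\<lambda>_. 0)"
    and eq: "\<And>e. e \<in> medges (contract G H) \<Longrightarrow> F1 e = F2 e"
  shows "(F1, F2) \<in> (flow_adjacent G D (\<lambda>_. 0))\<^sup>*"
  using F1 eq
proof (induction "card {e \<in> outer. F1 e \<noteq> F2 e}" arbitrary: F1 rule: less_induct)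
  case (less F1)
  show ?case
  proof (cases "{e \<in> outer. F1 e \<noteq> F2 e} = {}")
    case True
    then show ?thesis
      using frc less.prems(1) F2 by (intro equivalent_if_equal_outer) (auto simp: FRC_def)
  next
    case False
    then obtain e where e: "e \<in> outer" "F1 e \<noteq> F2 e" by blast
    have e': "e \<notin> medges (contract G H)" using e less.prems(2) by blast
    then have eH: "ends G e \<subseteq> mverts H" using edge_off_H[of e] e by blast
    define p where "p = F1(e := F2 e)"
    have T: "{e} = {e \<in> outer. F1 e \<noteq> p e}" using e by (auto simp: p_def)
    obtain F where F: "F \<in> flows G D (\<lambda>_. 0)" "\<And>e. e \<in> outer \<Longrightarrow> F e = p e"
      "(F1, F) \<in> (flow_adjacent G D (\<lambda>_. 0))\<^sup>*"
    proof (rule change_outer_values[OF frc less.prems(1) _ _ T])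
      show "p e' \<noteq> 0" if "e' \<in> outer" for e'
        using that flow_outer(1)[OF less.prems(1) that] flow_outer(1)[OF F2 that] by (auto simp: p_def)
      show "net D outer p v = 0" if "v \<in> mverts G - mverts H" for v
      proof -
        have "net D outer p v = net D outer F1 v"
          using that e' by (intro net_outer_cong) (auto simp: p_def)
        then show ?thesis by (simp add: flow_outer(2)[OF less.prems(1) that])
      qed
      show "card (edges_at (ends G) {e} v) \<le> 2" for v
      proof -
        have "card (edges_at (ends G) {e} v) \<le> card {e}"
          by (rule card_mono) (auto simp: edges_at_def)
        then show ?thesis by simp
      qed
      have "ends G e \<inter> mverts H = ends G e" "card (ends G e) = 2"
        using e eH G by (auto simp: multigraph_def)
      then show "(\<Sum>v\<in>mverts H. card (edges_at (ends G) {e} v)) \<le> 2"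
        using e by (simp add: sum_degree_H)
    qed (rule that)
    have "(F, F2) \<in> (flow_adjacent G D (\<lambda>_. 0))\<^sup>*"
    proof (rule less.hyps[OF _ F(1)])
      have "{e \<in> outer. F e \<noteq> F2 e} = {e \<in> outer. F1 e \<noteq> F2 e} - {e}"
        using F(2) by (auto simp: p_def split: if_splits)
      then show "card {e \<in> outer. F e \<noteq> F2 e} < card {e \<in> outer. F1 e \<noteq> F2 e}"
        using e finG by (intro psubset_card_mono) auto
      show "F e' = F2 e'" if "e' \<in> medges (contract G H)" for e'
      proof -
        have "e' \<in> outer" using that contract_edges by blast
        then show ?thesis using that F(2) less.prems(2) e' by (auto simp: p_def)
      qed
    qed
    then show ?thesis using F(3) by simp
  qed
qed

text \<open>
  The set \<open>T\<close> of changed edges lies on a cycle of \<open>G/H\<close>. An edge of \<open>G/H\<close> has at most one end in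
  \<open>H\<close>, so \<open>T\<close> meets \<open>H\<close> as often as it has edges at the contracted vertex, which is at most twice.
\<close>

lemma lift_adjacent:
  assumes frc: "FRC TYPE('a::ab_group_add) H"
    and F: "F \<in> flows G D (\<lambda>_. 0 :: 'a)"
    and adj: "(restrict F (medges (contract G H)), g) \<in> flow_adjacent (contract G H) D' (\<lambda>_. 0)"
  obtains F' where "F' \<in> flows G D (\<lambda>_. 0)" "restrict F' (medges (contract G H)) = g"
    "(F, F') \<in> (flow_adjacent G D (\<lambda>_. 0))\<^sup>*"
proof -
  let ?E' = "medges (contract G H)"
  obtain C where g: "g \<in> flows (contract G H) D' (\<lambda>_. 0)"
    and C: "msubgraph C (contract G H)" "is_cycle C"
      "\<forall>e\<in>?E' - medges C. restrict F ?E' e = g e"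
    using adj by (auto simp: flow_adjacent_def)
  define p where "p e = (if e \<in> ?E' then g e else F e)" for e
  define T where "T = {e \<in> outer. F e \<noteq> p e}"
  have T: "T \<subseteq> ?E'" "T \<subseteq> medges C"
    using C(3) by (auto simp: T_def p_def split: if_splits)
  have finT: "finite T" using finG by (simp add: T_def)
  have degC: "card (edges_at (ends (contract G H)) T x) \<le> 2" for x
    by (rule cycle_degree_le_2[OF C(1,2) T(2)])
  obtain F' where F': "F' \<in> flows G D (\<lambda>_. 0)" "\<And>e. e \<in> outer \<Longrightarrow> F' e = p e"
    "(F, F') \<in> (flow_adjacent G D (\<lambda>_. 0))\<^sup>*"
  proof (rule change_outer_values[OF frc F _ _ T_def])
    show "p e \<noteq> 0" if "e \<in> outer" for e
      using that g flow_outer(1)[OF F] by (auto simp: p_def contract_flow_iff)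
    show "net D outer p v = 0" if "v \<in> mverts G - mverts H" for v
      using that net_outer_cong[of v p g] g by (auto simp: p_def contract_flow_iff)
    show "card (edges_at (ends G) T v) \<le> 2" if "v \<in> mverts G - mverts H" for v
    proof -
      have "edges_at (ends G) T v = edges_at (ends (contract G H)) T (Some v)"
        using that by (auto simp: edges_at_def ends_contract contract_vertex_def image_iff split: if_splits)
      then show ?thesis using degC by simp
    qed
    have one: "card (ends G e \<inter> mverts H) \<le> (if None \<in> ends (contract G H) e then 1 else 0)"
      if "e \<in> T" for e
    proof -
      have "e \<in> ?E'" using that T by blast
      then have e: "e \<in> medges G" "card (contract_vertex H ` ends G e) = 2"
        by (auto simp: contract_def)
      obtain a b where ab: "ends G e = {a, b}"
        using orientation_ends[OF D e(1)] by blast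
      show ?thesis
        using e(2) ab
        by (auto simp: contract_vertex_def ends_contract Int_insert_left split: if_splits)
    qed
    have "(\<Sum>v\<in>mverts H. card (edges_at (ends G) T v)) = (\<Sum>e\<in>T. card (ends G e \<inter> mverts H))"
      using T_def by (intro sum_degree_H) auto
    also have "\<dots> \<le> (\<Sum>e\<in>T. if None \<in> ends (contract G H) e then 1 else 0)"
      by (rule sum_mono) (rule one)
    also have "\<dots> = card (edges_at (ends (contract G H)) T None)"
      using finT by (simp add: sum.If_cases edges_at_def Int_def)
    finally show "(\<Sum>v\<in>mverts H. card (edges_at (ends G) T v)) \<le> 2"
      using degC[of None] by simp
  qed (rule that)
  have "restrict F' ?E' = g"
  proof
    show "restrict F' ?E' e = g e" for e
      using F'(2)[of e] g contract_edges
      by (cases "e \<in> ?E'") (auto simp: p_def contract_flow_iff PiE_iff extensional_def)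
  qed
  then show thesis using that F' by blast
qed

text \<open>
  Following a sequence of adjacent flows of \<open>G/H\<close> with lifts, starting at \<open>F1\<close>, leads to a flow with
  the restriction of \<open>F2\<close>, though perhaps not to \<open>F2\<close> itself.
\<close>

lemma flow_connected_from_contract:
  assumes frc: "FRC TYPE('a::ab_group_add) H"
    and conn: "group_flow_connected TYPE('a) (contract G H)"
    and F1: "F1 \<in> flows G D (\<lambda>_. 0 :: 'a)" and F2: "F2 \<in> flows G D (\<lambda>_. 0)"
  shows "(F1, F2) \<in> (flow_adjacent G D (\<lambda>_. 0))\<^sup>*"
proof -
  let ?r = "\<lambda>F. restrict F (medges (contract G H))"
  have "(?r F1, ?r F2) \<in> (flow_adjacent (contract G H) D' (\<lambda>_. 0))\<^sup>*"
    using conn D' restrict_flow[OF F1] restrict_flow[OF F2]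
    by (auto simp: group_flow_connected_def flow_connected_def)
  then have "\<exists>F\<in>flows G D (\<lambda>_. 0). ?r F = ?r F2 \<and> (F1, F) \<in> (flow_adjacent G D (\<lambda>_. 0))\<^sup>*"
  proof induction
    case base
    then show ?case using F1 by blast
  next
    case (step g g')
    then obtain F where F: "F \<in> flows G D (\<lambda>_. 0)" "?r F = g"
      "(F1, F) \<in> (flow_adjacent G D (\<lambda>_. 0))\<^sup>*" by blast
    obtain F' where "F' \<in> flows G D (\<lambda>_. 0)" "?r F' = g'"
      "(F, F') \<in> (flow_adjacent G D (\<lambda>_. 0))\<^sup>*"
      using lift_adjacent[OF frc F(1)] step.hyps(2) F(2) by blast
    moreover from F(3) this(3) have "(F1, F') \<in> (flow_adjacent G D (\<lambda>_. 0))\<^sup>*"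
      by (rule rtrancl_trans)
    ultimately show ?case by blast
  qed
  then obtain F where F: "F \<in> flows G D (\<lambda>_. 0)" "?r F = ?r F2"
    "(F1, F) \<in> (flow_adjacent G D (\<lambda>_. 0))\<^sup>*" by blast
  have "(F, F2) \<in> (flow_adjacent G D (\<lambda>_. 0))\<^sup>*"
    using equivalent_if_equal_contract[OF frc F(1) F2] F(2) by (metis restrict_apply')
  then show ?thesis using F(3) by simp
qed

end

section \<open>Corresponding orientations and the theorem\<close>

lemma contraction_from_orientation:
  assumes G: "multigraph G" and HG: "msubgraph H G" and D: "orientation G D"
  shows "contraction G H D \<lparr>verts = mverts (contract G H), arcs = medges (contract G H),
    tail = contract_vertex H \<circ> tail D, head = contract_vertex H \<circ> head D\<rparr>"
  using assms orientation_ends[OF D]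
  by unfold_locales (auto simp: orientation_def contract_def)

text \<open>
  Start from any orientation of \<open>G\<close> and reverse the edges on which it disagrees with \<open>D'\<close>.
\<close>

lemma contraction_from_contract_orientation:
  assumes G: "multigraph G" and HG: "msubgraph H G" and D': "orientation (contract G H) D'"
  obtains D where "contraction G H D D'"
proof -
  obtain D0 where D0: "orientation G D0"
    using orientation_exists[OF G] by blast
  let ?\<pi> = "contract_vertex H" and ?E' = "medges (contract G H)"
  define keep where "keep e \<longleftrightarrow> e \<notin> ?E' \<or> tail D' e = ?\<pi> (tail D0 e)" for e
  define D where "D = \<lparr>verts = mverts G, arcs = medges G,
    tail = (\<lambda>e. if keep e then tail D0 e else head D0 e),
    head = (\<lambda>e. if keep e then head D0 e else tail D0 e)\<rparr>"
  have "orientation G D"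
    using D0 by (auto simp: orientation_def D_def)
  moreover have "tail D' e = ?\<pi> (tail D e) \<and> head D' e = ?\<pi> (head D e)" if "e \<in> ?E'" for e
  proof -
    have "e \<in> medges G" using that by (simp add: contract_def)
    then have "{tail D' e, head D' e} = {?\<pi> (tail D0 e), ?\<pi> (head D0 e)}"
      using orientation_ends[OF D' that] orientation_ends[OF D0] by (simp add: contract_def)
    then show ?thesis
      by (auto simp: D_def keep_def that doubleton_eq_iff)
  qed
  ultimately have "contraction G H D D'"
    using assms by unfold_locales auto
  then show thesis by (rule that)
qed

theorem theorem5p9:
  fixes G H :: "('v, 'e) mgraph"
  assumes "multigraph G" and "msubgraph H G"
  shows "(group_connected TYPE('a::{finite, ab_group_add}) H \<longrightarrow>
            group_flow_connected TYPE('a) G \<longrightarrow> group_flow_connected TYPE('a) (contract G H)) \<and>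
         (FRC TYPE('a) H \<longrightarrow>
            (group_flow_connected TYPE('a) (contract G H) \<longleftrightarrow> group_flow_connected TYPE('a) G))"
proof -
  have down: "group_flow_connected TYPE('a) (contract G H)"
    if "group_connected TYPE('a) H" "group_flow_connected TYPE('a) G"
    unfolding group_flow_connected_def flow_connected_def
  proof (intro allI impI ballI)
    fix D' and f g :: "'e \<Rightarrow> 'a"
    assume D': "orientation (contract G H) D'"
      and fg: "f \<in> flows (contract G H) D' (\<lambda>_. 0)" "g \<in> flows (contract G H) D' (\<lambda>_. 0)"
    obtain D where "contraction G H D D'"
      using contraction_from_contract_orientation[OF assms D'] .
    then show "(f, g) \<in> (flow_adjacent (contract G H) D' (\<lambda>_. 0))\<^sup>*"
      by (rule contraction.contract_flow_connected) (fact that fg)+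
  qed
  moreover have "group_flow_connected TYPE('a) G"
    if "FRC TYPE('a) H" "group_flow_connected TYPE('a) (contract G H)"
    unfolding group_flow_connected_def flow_connected_def
  proof (intro allI impI ballI)
    fix D and f g :: "'e \<Rightarrow> 'a"
    assume D: "orientation G D" and fg: "f \<in> flows G D (\<lambda>_. 0)" "g \<in> flows G D (\<lambda>_. 0)"
    show "(f, g) \<in> (flow_adjacent G D (\<lambda>_. 0))\<^sup>*"
      by (rule contraction.flow_connected_from_contract[OF contraction_from_orientation[OF assms D]])
        (fact that fg)+
  qed
  ultimately show ?thesis
    by (auto simp: FRC_def)
qed

end
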